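(* Let $\boldsymbol c=(c_m)_{m\in\mathbb N_0}$ be an absolutely summable sequence of real numbers and let $f:[0,1]\to\mathbb R$, $f(t)=\sum_{m=0}^\infty c_m\phi(2^mt)$. Let the sequences $\boldsymbol\rho^\flat,\boldsymbol\rho^\sharp\in\{-1,+1\}^{\mathbb N_0}$ be defined recursively by $\rho^\flat_0=\rho^\sharp_0=1$ and, for $n\in\mathbb N$, $$\rho_n^\flat=\begin{cases}+1&\text{if }\sum_{m=0}^{n-1}2^mc_m\rho^\flat_m<0,\\-1&\text{otherwise,}\end{cases}\qquad \rho_n^\sharp=\begin{cases}+1&\text{if }\sum_{m=0}^{n-1}2^mc_m\rho^\sharp_m\le0,\\-1&\text{otherwise.}\end{cases}$$ Then $T(\boldsymbol\rho^\flat)$ is the largest and $T(\boldsymbol\rho^\sharp)$ is the smallest maximizer of $f$ in $[0,1/2]$.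
   Context: $\mathbb N_0=\{0,1,2,\dots\}$, $\mathbb N=\{1,2,\dots\}$. The tent map is $\phi(t)=\min_{z\in\mathbb Z}|t-z|$. For a $\{-1,+1\}$-valued sequence $\boldsymbol\rho$, $T(\boldsymbol\rho):=\sum_{n=0}^\infty 2^{-(n+2)}(1-\rho_n)\in[0,1]$. A maximizer of $f$ is a point of $[0,1]$ at which the global maximum of $f$ over $[0,1]$ is attained; a maximizer in $[0,1/2]$ is such a point lying in $[0,1/2]$. *)

theory Defs
  imports "HOL-Analysis.Analysis"
begin

text \<open>The infimum over all integers is attained, see \<open>tent_attained\<close>.\<close>
definition tent :: "real \<Rightarrow> real" where
  "tent t = (INF z::int. \<bar>t - of_int z\<bar>)"

lemma tent_le: "tent t \<le> \<bar>t - of_int z\<bar>"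
  unfolding tent_def by (rule cINF_lower) (auto intro!: bdd_belowI[of _ 0])

lemma tent_attained: "\<exists>z::int. tent t = \<bar>t - of_int z\<bar>"
proof -
  have "\<bar>t - of_int (round t)\<bar> \<le> \<bar>t - of_int z\<bar>" for z :: int
    using round_diff_minimal[of t z] by simp
  then have "\<bar>t - of_int (round t)\<bar> \<le> tent t"
    unfolding tent_def by (intro cINF_greatest) auto
  then show ?thesis
    using tent_le[of t "round t"] by (intro exI[of _ "round t"]) linarith
qed

definition takagi_fun :: "(nat \<Rightarrow> real) \<Rightarrow> real \<Rightarrow> real" where
  "takagi_fun c t = (\<Sum>m. c m * tent (2 ^ m * t))"

definition T :: "(nat \<Rightarrow> real) \<Rightarrow> real" where
  "T \<rho> = (\<Sum>n. (1 - \<rho> n) / 2 ^ (n + 2))"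

context
  notes sum.cong [fundef_cong]
begin

fun rho_flat :: "(nat \<Rightarrow> real) \<Rightarrow> nat \<Rightarrow> real" where
  "rho_flat c 0 = 1"
| "rho_flat c (Suc n) = (if (\<Sum>m=0..n. 2 ^ m * c m * rho_flat c m) < 0 then 1 else - 1)"

fun rho_sharp :: "(nat \<Rightarrow> real) \<Rightarrow> nat \<Rightarrow> real" where
  "rho_sharp c 0 = 1"
| "rho_sharp c (Suc n) = (if (\<Sum>m=0..n. 2 ^ m * c m * rho_sharp c m) \<le> 0 then 1 else - 1)"

end

text \<open>Points of the whole unit interval at which the global maximum over \<open>[0,1]\<close> is attained.\<close>
definition maximizers :: "(real \<Rightarrow> real) \<Rightarrow> real set" where
  "maximizers f = {t. is_arg_max f (\<lambda>s. s \<in> {0..1}) t}"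

lemma mem_maximizers_iff: "t \<in> maximizers f \<longleftrightarrow> t \<in> {0..1} \<and> (\<forall>s\<in>{0..1}. f s \<le> f t)"
  unfolding maximizers_def is_arg_max_linorder by auto

definition is_largest :: "real set \<Rightarrow> real \<Rightarrow> bool" where
  "is_largest A x \<longleftrightarrow> x \<in> A \<and> (\<forall>y\<in>A. y \<le> x)"

definition is_smallest :: "real set \<Rightarrow> real \<Rightarrow> bool" where
  "is_smallest A x \<longleftrightarrow> x \<in> A \<and> (\<forall>y\<in>A. x \<le> y)"

end

theory Submission
  imports Defs
begin

text \<open>
  Write \<open>t = T \<rho>\<close>, \<open>S n = (\<Sum>m<n. 2 ^ m * c m * \<rho> m)\<close> and \<open>R n = (\<Sum>k. \<rho> (n + k) / 2 ^ k)\<close>.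
  Summation by parts expresses the partial sums of \<open>4 f(t)\<close> through \<open>c\<close>, the products \<open>\<rho> n * S n\<close>
  and a remainder \<open>S N * R N / 2 ^ N\<close> that tends to zero. Flipping all signs from position \<open>n\<close> on
  changes \<open>f\<close> by a positive multiple of \<open>S n * R n\<close>, and \<open>R n\<close> has the sign \<open>\<rho> n\<close> unless it
  vanishes, which happens for at most one \<open>n\<close>. Hence a maximizer has an expansion with
  \<open>\<rho> n * S n \<le> 0\<close> for all \<open>n\<close>. Conversely, all such expansions give the same value of \<open>f\<close>, since
  \<open>\<rho> n * S n = - \<bar>S n\<bar>\<close> and \<open>\<bar>S (Suc n)\<bar> = \<bar>2 ^ n * c n - \<bar>S n\<bar>\<bar>\<close> no longer depend on \<open>\<rho>\<close>.
  The sequences \<open>\<rho>\<^sup>\<flat>\<close> and \<open>\<rho>\<^sup>\<sharp>\<close> are the lexicographically extreme ones among them.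
\<close>

section \<open>Sign expansions\<close>

definition sign_seq :: "(nat \<Rightarrow> real) \<Rightarrow> bool" where
  "sign_seq \<rho> \<longleftrightarrow> (\<forall>n. \<rho> n = 1 \<or> \<rho> n = - 1)"

text \<open>Modulo integers, \<open>2 ^ n * T \<rho>\<close> equals
  \<open>1 / 2 - sign_tail \<rho> n / 4\<close>: the tail is a centred fractional part.\<close>

definition sign_tail :: "(nat \<Rightarrow> real) \<Rightarrow> nat \<Rightarrow> real" where
  "sign_tail \<rho> n = (\<Sum>k. \<rho> (n + k) / 2 ^ k)"

text \<open>Under \<open>T\<close> this is the reflection at the midpoint of the dyadic interval of
  length \<open>1 / 2 ^ n\<close> fixed by the first \<open>n\<close> signs.\<close>

definition flip_from :: "nat \<Rightarrow> (nat \<Rightarrow> real) \<Rightarrow> nat \<Rightarrow> real" where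
  "flip_from n \<rho> m = (if m < n then \<rho> m else - \<rho> m)"

lemma sign_seqD: "sign_seq \<rho> \<Longrightarrow> \<rho> n = 1 \<or> \<rho> n = - 1"
  by (simp add: sign_seq_def)

lemma sign_seq_flip_from: "sign_seq \<rho> \<Longrightarrow> sign_seq (flip_from n \<rho>)"
  by (fastforce simp: sign_seq_def flip_from_def)

lemma sums_halves: "(\<lambda>k. 1 / 2 ^ k :: real) sums 2"
  using geometric_sums[of "1 / 2 :: real"] by (simp add: power_divide)

lemma sign_tail_abs_summable:
  assumes "sign_seq \<rho>"
  shows "summable (\<lambda>k. \<bar>\<rho> (n + k) / 2 ^ k\<bar>)"
proof -
  have "\<bar>\<rho> m\<bar> = 1" for m
    using sign_seqD[OF assms, of m] by auto
  then show ?thesis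
    using sums_halves by (simp add: abs_divide sums_iff)
qed

lemma sign_tail_summable: "sign_seq \<rho> \<Longrightarrow> summable (\<lambda>k. \<rho> (n + k) / 2 ^ k)"
  using summable_rabs_cancel[OF sign_tail_abs_summable] .

lemma abs_sign_tail_le:
  assumes "sign_seq \<rho>"
  shows "\<bar>sign_tail \<rho> n\<bar> \<le> 2"
proof -
  have "\<bar>\<rho> m\<bar> = 1" for m
    using sign_seqD[OF assms, of m] by auto
  then have "(\<Sum>k. \<bar>\<rho> (n + k) / 2 ^ k\<bar>) = 2"
    using sums_halves by (simp add: abs_divide sums_iff)
  then show ?thesis
    using summable_rabs[OF sign_tail_abs_summable[OF assms, of n]] by (simp add: sign_tail_def)
qed

lemma sign_tail_rec:
  assumes "sign_seq \<rho>"
  shows "sign_tail \<rho> n = \<rho> n + sign_tail \<rho> (Suc n) / 2"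
proof -
  have "sign_tail \<rho> n - \<rho> n = (\<Sum>k. \<rho> (n + Suc k) / 2 ^ Suc k)"
    using suminf_split_head[OF sign_tail_summable[OF assms, of n]] by (simp add: sign_tail_def)
  also have "\<dots> = (\<Sum>k. \<rho> (Suc n + k) / 2 ^ k / 2)"
    by (simp add: mult.commute)
  also have "\<dots> = sign_tail \<rho> (Suc n) / 2"
    unfolding sign_tail_def by (rule suminf_divide[OF sign_tail_summable[OF assms]])
  finally show ?thesis by simp
qed

lemma sign_tail_split:
  assumes "sign_seq \<rho>"
  shows "sign_tail \<rho> 0 = (\<Sum>k<n. \<rho> k / 2 ^ k) + sign_tail \<rho> n / 2 ^ n"
proof (induction n)
  case (Suc n)
  then show ?case
    using sign_tail_rec[OF assms, of n] by (simp add: field_simps)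
qed simp

text \<open>The later signs contribute at most \<open>1\<close> in absolute value, so they can
  cancel the leading sign but not outweigh it.\<close>

lemma sign_mult_tail_nonneg:
  assumes "sign_seq \<rho>"
  shows "0 \<le> \<rho> n * sign_tail \<rho> n"
  using sign_seqD[OF assms, of n] sign_tail_rec[OF assms, of n] abs_sign_tail_le[OF assms, of "Suc n"]
  by (auto simp: abs_le_iff)

text \<open>If \<open>R i = 0\<close>, then \<open>\<bar>R\<bar>\<close> stays at its maximal value \<open>2\<close> from \<open>Suc i\<close> on.\<close>
lemma sign_tail_zero_unique:
  assumes "sign_seq \<rho>" "sign_tail \<rho> i = 0" "sign_tail \<rho> j = 0"
  shows "i = j"
proof -
  have *: "\<bar>sign_tail \<rho> (Suc i + k)\<bar> = 2" if "sign_tail \<rho> i = 0" for i k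
  proof (induction k)
    case 0
    show ?case
      using sign_seqD[OF assms(1), of i] sign_tail_rec[OF assms(1), of i] that by auto
  next
    case (Suc k)
    then show ?case
      using sign_seqD[OF assms(1), of "Suc i + k"] sign_tail_rec[OF assms(1), of "Suc i + k"]
        abs_sign_tail_le[OF assms(1), of "Suc (Suc i + k)"]
      by (auto simp: abs_if split: if_splits)
  qed
  have "\<not> i < j" if "sign_tail \<rho> i = 0" "sign_tail \<rho> j = 0" for i j
    using *[OF that(1), of "j - Suc i"] that(2) by auto
  from this[OF assms(2,3)] this[OF assms(3,2)] show ?thesis by simp
qed

lemma T_eq_sign_tail:
  assumes "sign_seq \<rho>"
  shows "T \<rho> = 1 / 2 - sign_tail \<rho> 0 / 4"
proof -
  have "(\<lambda>k. 1 / 2 ^ k / 4 - \<rho> (0 + k) / 2 ^ k / 4) sums (2 / 4 - sign_tail \<rho> 0 / 4)"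
    unfolding sign_tail_def
    by (intro sums_diff sums_divide sums_halves summable_sums sign_tail_summable assms)
  then show ?thesis
    by (simp add: T_def sums_iff diff_divide_distrib mult.commute)
qed

lemma T_bounds: "sign_seq \<rho> \<Longrightarrow> T \<rho> \<in> {0..1}"
  using abs_sign_tail_le[of \<rho> 0] by (auto simp: T_eq_sign_tail abs_le_iff)

lemma T_bounds_half: "sign_seq \<rho> \<Longrightarrow> \<rho> 0 = 1 \<Longrightarrow> T \<rho> \<in> {0..1/2}"
  using sign_mult_tail_nonneg[of \<rho> 0] T_bounds[of \<rho>] by (auto simp: T_eq_sign_tail)

text \<open>The sign \<open>- 1\<close> encodes the binary digit 1, so \<open>T\<close> reverses the
  order of signs. The inequality is weak because dyadic points have two expansions.\<close>

lemma T_mono_lex: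
  assumes "sign_seq \<rho>" "sign_seq \<sigma>" "\<And>k. k < n \<Longrightarrow> \<rho> k = \<sigma> k" "\<rho> n = 1" "\<sigma> n = - 1"
  shows "T \<rho> \<le> T \<sigma>"
proof -
  have "(\<Sum>k<n. \<rho> k / 2 ^ k) = (\<Sum>k<n. \<sigma> k / 2 ^ k)"
    using assms(3) by simp
  moreover have "sign_tail \<sigma> n / 2 ^ n \<le> sign_tail \<rho> n / 2 ^ n"
    using sign_mult_tail_nonneg[OF assms(1), of n] sign_mult_tail_nonneg[OF assms(2), of n] assms(4,5)
    by (intro divide_right_mono) auto
  ultimately show ?thesis
    using sign_tail_split[OF assms(1), of n] sign_tail_split[OF assms(2), of n]
    unfolding T_eq_sign_tail[OF assms(1)] T_eq_sign_tail[OF assms(2)] by linarith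
qed

lemma sign_tail_flip_from_above:
  assumes "sign_seq \<rho>" "n \<le> m"
  shows "sign_tail (flip_from n \<rho>) m = - sign_tail \<rho> m"
  using suminf_minus[OF sign_tail_summable[OF assms(1), of m]] assms(2) by (simp add: sign_tail_def flip_from_def)

text \<open>A zero tail places the point at the midpoint, which the reflection fixes; the flip
  passes to its other binary expansion.\<close>

lemma T_flip_from:
  assumes "sign_seq \<rho>" "sign_tail \<rho> n = 0"
  shows "T (flip_from n \<rho>) = T \<rho>"
proof -
  note sign_seq_flip_from[OF assms(1), of n]
  moreover have "(\<Sum>k<n. flip_from n \<rho> k / 2 ^ k) = (\<Sum>k<n. \<rho> k / 2 ^ k)"
    by (simp add: flip_from_def)
  ultimately show ?thesis
    using sign_tail_split[of \<rho> n] sign_tail_split[of "flip_from n \<rho>" n] assms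
    by (simp add: T_eq_sign_tail sign_tail_flip_from_above)
qed

text \<open>At \<open>1/2\<close> the digit \<open>1\<close> is chosen, so that points of \<open>[0,1/2]\<close> get an expansion with leading sign \<open>1\<close>.\<close>
primrec doubling_orbit :: "real \<Rightarrow> nat \<Rightarrow> real" where
  "doubling_orbit t 0 = t"
| "doubling_orbit t (Suc n) =
    (if doubling_orbit t n \<le> 1 / 2 then 2 * doubling_orbit t n else 2 * doubling_orbit t n - 1)"

lemma sign_expansion_exists:
  assumes "t \<in> {0..1}"
  obtains \<rho> where "sign_seq \<rho>" "T \<rho> = t" "t \<le> 1 / 2 \<Longrightarrow> \<rho> 0 = 1"
proof -
  define \<rho> where "\<rho> n = (if doubling_orbit t n \<le> 1 / 2 then 1 else - 1 :: real)" for n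
  have bounds: "doubling_orbit t n \<in> {0..1}" for n
    using assms by (induction n) auto
  have orbit_Suc: "doubling_orbit t (Suc n) = 2 * doubling_orbit t n - (1 - \<rho> n) / 2" for n
    by (simp add: \<rho>_def)
  \<comment> \<open>By \<open>orbit_Suc\<close>, the \<open>n\<close>-th summand is the difference
    of \<open>doubling_orbit t n / 2 ^ n\<close> and its successor, so the sum telescopes.\<close>
  have "(\<Sum>n<N. (1 - \<rho> n) / 2 ^ (n + 2)) = t - doubling_orbit t N / 2 ^ N" for N
  proof (induction N)
    case (Suc N)
    show ?case
      unfolding sum.lessThan_Suc Suc.IH orbit_Suc by (simp add: field_simps)
  qed simp
  moreover have "(\<lambda>N. t - doubling_orbit t N / 2 ^ N) \<longlonglongrightarrow> t - 0"
  proof (intro tendsto_diff tendsto_const)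
    show "(\<lambda>N. doubling_orbit t N / 2 ^ N) \<longlonglongrightarrow> 0"
      by (rule Lim_null_comparison[OF _ sums_summable[OF sums_halves, THEN summable_LIMSEQ_zero]])
        (use bounds in \<open>auto simp: divide_right_mono\<close>)
  qed
  ultimately have "(\<lambda>n. (1 - \<rho> n) / 2 ^ (n + 2)) sums t"
    by (simp add: sums_def)
  then have "T \<rho> = t"
    by (simp add: T_def sums_iff)
  then show thesis
    by (rule that[rotated]) (auto simp: sign_seq_def \<rho>_def)
qed

section \<open>Values of the generalized Takagi function\<close>

lemma tent_nonneg: "0 \<le> tent t"
  using tent_attained[of t] by auto

lemma tent_le_1: "tent t \<le> 1"
  using tent_le[of t "\<lfloor>t\<rfloor>"] by linarith

lemma tent_add_int: "tent (t + of_int k) = tent t"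
proof (rule antisym)
  obtain z where "tent t = \<bar>t - of_int z\<bar>" using tent_attained by blast
  then show "tent (t + of_int k) \<le> tent t"
    using tent_le[of "t + of_int k" "z + k"] by simp
  obtain w where "tent (t + of_int k) = \<bar>t + of_int k - of_int w\<bar>" using tent_attained by blast
  then show "tent t \<le> tent (t + of_int k)"
    using tent_le[of t "w - k"] by (simp add: algebra_simps)
qed

lemma tent_eq_min:
  assumes "t \<in> {0..1}"
  shows "tent t = min t (1 - t)"
proof (rule antisym)
  show "tent t \<le> min t (1 - t)"
    using tent_le[of t 0] tent_le[of t 1] assms by simp
  obtain z where z: "tent t = \<bar>t - of_int z\<bar>" using tent_attained by blast
  consider "z \<le> 0" | "z \<ge> 1" by linarith
  then show "min t (1 - t) \<le> tent t"
  proof cases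
    case 1
    then have "real_of_int z \<le> 0" by simp
    with z show ?thesis by linarith
  next
    case 2
    then have "real_of_int z \<ge> 1" by simp
    with z show ?thesis by linarith
  qed
qed

lemma continuous_on_tent: "continuous_on A tent"
proof -
  have "tent x \<le> tent y + dist x y" for x y
  proof -
    obtain z where "tent y = \<bar>y - of_int z\<bar>" using tent_attained by blast
    then show ?thesis
      using tent_le[of x z] by (simp add: dist_real_def)
  qed
  then have "dist (tent x) (tent y) \<le> dist x y" for x y
    using dist_commute[of x y] by (smt (verit) dist_real_def)
  then show ?thesis
    unfolding continuous_on_iff by (meson le_less_trans)
qed

lemma tent_pow_T:
  assumes "sign_seq \<rho>"
  shows "tent (2 ^ m * T \<rho>) = (1 - \<rho> m * sign_tail \<rho> (Suc m) / 2) / 4"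
proof -
  let ?s = "1 / 2 - sign_tail \<rho> m / 4"
  have "\<exists>k::int. 2 ^ m * T \<rho> = 1 / 2 - sign_tail \<rho> m / 4 + of_int k"
  proof (induction m)
    case 0
    show ?case by (rule exI[of _ 0]) (simp add: T_eq_sign_tail assms)
  next
    case (Suc m)
    then obtain k :: int where k: "2 ^ m * T \<rho> = 1 / 2 - sign_tail \<rho> m / 4 + of_int k" by blast
    \<comment> \<open>Doubling turns the integer part \<open>k\<close> into \<open>2 * k\<close>
      plus the binary digit \<open>(1 - \<rho> m) / 2\<close>.\<close>
    consider "\<rho> m = 1" | "\<rho> m = - 1" using sign_seqD[OF assms] by blast
    then show ?case
    proof cases
      case 1
      then show ?thesis
        using k sign_tail_rec[OF assms, of m] by (intro exI[of _ "2 * k"]) (simp add: field_simps)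
    next
      case 2
      then show ?thesis
        using k sign_tail_rec[OF assms, of m] by (intro exI[of _ "2 * k + 1"]) (simp add: field_simps)
    qed
  qed
  then have "tent (2 ^ m * T \<rho>) = tent ?s"
    using tent_add_int by metis
  also have "\<dots> = min ?s (1 - ?s)"
    using abs_sign_tail_le[OF assms, of m] by (intro tent_eq_min) (auto simp: abs_le_iff)
  \<comment> \<open>The sign \<open>\<rho> m\<close> decides which half of the unit interval
    contains \<open>?s\<close>, hence which argument is the minimum.\<close>
  also have "\<dots> = (1 - \<rho> m * sign_tail \<rho> (Suc m) / 2) / 4"
    using sign_seqD[OF assms, of m] sign_tail_rec[OF assms, of m]
      abs_sign_tail_le[OF assms, of "Suc m"]
    by (auto simp: min_def abs_le_iff field_simps)
  finally show ?thesis .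
qed

text \<open>This is the slope of the \<open>n\<close>-th partial sum of the series for
  \<open>takagi_fun c\<close> on the dyadic interval selected by the first \<open>n\<close>
  signs.\<close>

definition signed_sum :: "(nat \<Rightarrow> real) \<Rightarrow> (nat \<Rightarrow> real) \<Rightarrow> nat \<Rightarrow> real" where
  "signed_sum c \<rho> n = (\<Sum>m<n. 2 ^ m * c m * \<rho> m)"

lemma signed_sum_0 [simp]: "signed_sum c \<rho> 0 = 0"
  by (simp add: signed_sum_def)

lemma signed_sum_Suc [simp]: "signed_sum c \<rho> (Suc n) = signed_sum c \<rho> n + 2 ^ n * c n * \<rho> n"
  by (simp add: signed_sum_def)

lemma signed_sum_cong: "(\<And>k. k < n \<Longrightarrow> \<rho> k = \<sigma> k) \<Longrightarrow> signed_sum c \<rho> n = signed_sum c \<sigma> n"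
  by (simp add: signed_sum_def)

text \<open>Unfolding \<open>sign_tail \<rho> N\<close> once in the remainder produces the next
  product term; the new summand of \<open>signed_sum\<close> accounts for the tail in
  \<open>tent_pow_T\<close>.\<close>

lemma takagi_partial_sum:
  assumes "sign_seq \<rho>"
  shows "(\<Sum>m<N. c m * tent (2 ^ m * T \<rho>)) =
    ((\<Sum>m<N. c m) - (\<Sum>n<N. \<rho> n * signed_sum c \<rho> n / 2 ^ n)
      - signed_sum c \<rho> N * sign_tail \<rho> N / 2 ^ N) / 4"
proof (induction N)
  case (Suc N)
  show ?case
    unfolding sum.lessThan_Suc Suc.IH signed_sum_Suc tent_pow_T[OF assms, of N]
      sign_tail_rec[OF assms, of N]
    by (simp add: field_simps)
qed simp

context
  fixes c :: "nat \<Rightarrow> real"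
  assumes c_summable: "summable (\<lambda>m. \<bar>c m\<bar>)"
begin

lemma takagi_summable: "summable (\<lambda>m. c m * tent (2 ^ m * t))"
  by (rule summable_comparison_test'[OF c_summable, of 0])
    (simp add: abs_mult mult_left_le tent_nonneg tent_le_1)

lemma continuous_on_takagi_fun: "continuous_on A (takagi_fun c)"
proof -
  have "uniform_limit A (\<lambda>n t. \<Sum>m<n. c m * tent (2 ^ m * t)) (takagi_fun c) sequentially"
    unfolding takagi_fun_def
    by (rule Weierstrass_m_test[OF _ c_summable])
      (simp add: abs_mult mult_left_le tent_nonneg tent_le_1)
  moreover have "continuous_on A (\<lambda>t. \<Sum>m<n. c m * tent (2 ^ m * t))" for n
    by (intro continuous_intros continuous_on_compose2[OF continuous_on_tent[of UNIV]]) auto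
  ultimately show ?thesis
    by (intro uniform_limit_theorem[where F = sequentially]) auto
qed

text \<open>Up to the factor \<open>1 / 2\<close>, these are the terms of the Cauchy product of
  \<open>c m * \<rho> m\<close> with a geometric series. Both converge absolutely, so the terms tend
  to zero.\<close>

lemma signed_sum_over_pow_tendsto_0:
  assumes "sign_seq \<rho>"
  shows "(\<lambda>n. signed_sum c \<rho> n / 2 ^ n) \<longlonglongrightarrow> 0"
proof -
  have "\<bar>c m * \<rho> m\<bar> = \<bar>c m\<bar>" for m
    using sign_seqD[OF assms, of m] by auto
  then have "summable (\<lambda>n. \<Sum>m\<le>n. c m * \<rho> m * (1 / 2) ^ (n - m))"
    using c_summable by (intro summable_Cauchy_product) auto
  then have "(\<lambda>n. (\<Sum>m\<le>n. c m * \<rho> m * (1 / 2) ^ (n - m)) / 2) \<longlonglongrightarrow> 0 / 2"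
    by (intro tendsto_divide summable_LIMSEQ_zero) auto
  moreover have "(\<Sum>m\<le>n. c m * \<rho> m * (1 / 2) ^ (n - m)) / 2 = signed_sum c \<rho> (Suc n) / 2 ^ Suc n" for n
  proof -
    have "(\<Sum>m\<le>n. c m * \<rho> m * (1 / 2) ^ (n - m)) = (\<Sum>m\<le>n. 2 ^ m * c m * \<rho> m / 2 ^ n)"
      by (intro sum.cong) (auto simp: power_diff power_divide)
    then show ?thesis
      by (simp add: signed_sum_def lessThan_Suc_atMost sum_divide_distrib mult.commute del: signed_sum_Suc)
  qed
  ultimately have "(\<lambda>n. signed_sum c \<rho> (Suc n) / 2 ^ Suc n) \<longlonglongrightarrow> 0"
    by (simp only: div_0)
  then show ?thesis by (rule LIMSEQ_imp_Suc)
qed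

lemma takagi_remainder_tendsto_0:
  assumes "sign_seq \<rho>"
  shows "(\<lambda>n. signed_sum c \<rho> n * sign_tail \<rho> n / 2 ^ n) \<longlonglongrightarrow> 0"
proof (rule Lim_null_comparison)
  show "(\<lambda>n. \<bar>signed_sum c \<rho> n / 2 ^ n\<bar> * 2) \<longlonglongrightarrow> 0"
    using tendsto_mult[OF tendsto_rabs_zero[OF signed_sum_over_pow_tendsto_0[OF assms]] tendsto_const[of 2]]
    by simp
  show "\<forall>\<^sub>F n in sequentially.
      norm (signed_sum c \<rho> n * sign_tail \<rho> n / 2 ^ n) \<le> \<bar>signed_sum c \<rho> n / 2 ^ n\<bar> * 2"
    using abs_sign_tail_le[OF assms]
    by (intro always_eventually allI) (simp add: abs_mult divide_right_mono mult_left_mono)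
qed

text \<open>The first \<open>n\<close> summands are affine on the dyadic interval, so they change by
  slope times displacement; the later summands are symmetric about its midpoint.\<close>

lemma takagi_flip_from:
  assumes "sign_seq \<rho>"
  shows "takagi_fun c (T (flip_from n \<rho>)) =
    takagi_fun c (T \<rho>) + signed_sum c \<rho> n * sign_tail \<rho> n / (2 * 2 ^ n)"
proof -
  let ?\<sigma> = "flip_from n \<rho>"
  have sgn: "sign_seq ?\<sigma>" by (rule sign_seq_flip_from[OF assms])
  have below: "signed_sum c ?\<sigma> k = signed_sum c \<rho> k" if "k \<le> n" for k
    using that by (intro signed_sum_cong) (auto simp: flip_from_def)
  have "(\<Sum>k<n. ?\<sigma> k * signed_sum c ?\<sigma> k / 2 ^ k) = (\<Sum>k<n. \<rho> k * signed_sum c \<rho> k / 2 ^ k)"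
    by (intro sum.cong) (auto simp: below flip_from_def)
  then have head: "(\<Sum>m<n. c m * tent (2 ^ m * T ?\<sigma>)) =
      (\<Sum>m<n. c m * tent (2 ^ m * T \<rho>)) + signed_sum c \<rho> n * sign_tail \<rho> n / (2 * 2 ^ n)"
    unfolding takagi_partial_sum[OF sgn] takagi_partial_sum[OF assms]
    by (simp add: below sign_tail_flip_from_above[OF assms] field_simps)
  have tail: "tent (2 ^ (m + n) * T ?\<sigma>) = tent (2 ^ (m + n) * T \<rho>)" for m
    unfolding tent_pow_T[OF sgn] tent_pow_T[OF assms]
    by (simp add: sign_tail_flip_from_above[OF assms] flip_from_def)
  show ?thesis
    unfolding takagi_fun_def suminf_split_initial_segment[OF takagi_summable, of _ n] head tail
    by simp
qed

section \<open>The step condition\<close>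

text \<open>Both signs are allowed where the signed sum vanishes. This includes index 0, so the
  leading sign is fixed separately to select the left half.\<close>

definition step_cond :: "(nat \<Rightarrow> real) \<Rightarrow> bool" where
  "step_cond \<rho> \<longleftrightarrow> sign_seq \<rho> \<and> \<rho> 0 = 1 \<and> (\<forall>n. \<rho> n * signed_sum c \<rho> n \<le> 0)"

lemma step_cond_sign_mult:
  assumes "step_cond \<rho>"
  shows "\<rho> n * signed_sum c \<rho> n = - \<bar>signed_sum c \<rho> n\<bar>"
proof -
  have "\<rho> n * signed_sum c \<rho> n \<le> 0" "\<rho> n = 1 \<or> \<rho> n = - 1"
    using assms by (simp_all add: step_cond_def sign_seq_def)
  then show ?thesis by auto
qed

lemma step_cond_abs_signed_sum_Suc:
  assumes "step_cond \<rho>"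
  shows "\<bar>signed_sum c \<rho> (Suc n)\<bar> = \<bar>2 ^ n * c n - \<bar>signed_sum c \<rho> n\<bar>\<bar>"
  using step_cond_sign_mult[OF assms, of n] assms sign_seqD[of \<rho> n]
  by (auto simp: step_cond_def)

lemma step_cond_takagi_eq:
  assumes "step_cond \<rho>" "step_cond \<sigma>"
  shows "takagi_fun c (T \<rho>) = takagi_fun c (T \<sigma>)"
proof -
  have sgn: "sign_seq \<rho>" "sign_seq \<sigma>" using assms by (auto simp: step_cond_def)
  have abs_eq: "\<bar>signed_sum c \<rho> n\<bar> = \<bar>signed_sum c \<sigma> n\<bar>" for n
    by (induction n) (simp_all add: step_cond_abs_signed_sum_Suc assms del: signed_sum_Suc)
  let ?r = "\<lambda>\<rho> n. signed_sum c \<rho> n * sign_tail \<rho> n / 2 ^ n"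
  \<comment> \<open>The sums of \<open>c\<close> cancel, and so do the product terms, both equal to
    minus the common absolute value; only the remainders survive.\<close>
  have "(\<Sum>m<N. c m * tent (2 ^ m * T \<rho>)) - (\<Sum>m<N. c m * tent (2 ^ m * T \<sigma>))
      = (?r \<sigma> N - ?r \<rho> N) / 4" for N
    unfolding takagi_partial_sum[OF sgn(1)] takagi_partial_sum[OF sgn(2)]
    by (simp add: step_cond_sign_mult assms abs_eq field_simps)
  moreover have "(\<lambda>N. (?r \<sigma> N - ?r \<rho> N) / 4) \<longlonglongrightarrow> (0 - 0) / 4"
    by (intro tendsto_divide tendsto_diff takagi_remainder_tendsto_0 sgn) auto
  moreover have "(\<lambda>N. (\<Sum>m<N. c m * tent (2 ^ m * T \<rho>)) - (\<Sum>m<N. c m * tent (2 ^ m * T \<sigma>)))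
      \<longlonglongrightarrow> takagi_fun c (T \<rho>) - takagi_fun c (T \<sigma>)"
    unfolding takagi_fun_def by (intro tendsto_diff summable_LIMSEQ takagi_summable)
  ultimately have "takagi_fun c (T \<rho>) - takagi_fun c (T \<sigma>) = (0 - 0) / 4"
    using LIMSEQ_unique by (metis (no_types, lifting) ext)
  then show ?thesis by simp
qed

section \<open>Maximizers and the step condition\<close>

lemma maximizer_signed_sum_mult_tail:
  assumes "sign_seq \<rho>" "T \<rho> \<in> maximizers (takagi_fun c)"
  shows "signed_sum c \<rho> n * sign_tail \<rho> n \<le> 0"
proof -
  have "takagi_fun c (T (flip_from n \<rho>)) \<le> takagi_fun c (T \<rho>)"
    using assms T_bounds[OF sign_seq_flip_from[OF assms(1)]] by (auto simp: mem_maximizers_iff)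
  then have "signed_sum c \<rho> n * sign_tail \<rho> n / (2 * 2 ^ n) \<le> 0"
    using takagi_flip_from[OF assms(1), of n] by linarith
  then show ?thesis
    by (simp add: pos_divide_le_eq)
qed

text \<open>Flipping cannot increase the maximal value, so a violated step condition makes
  \<open>\<rho> n * sign_tail \<rho> n\<close> nonpositive, while it is always nonnegative.\<close>

lemma maximizer_sign_tail_eq_0:
  assumes "sign_seq \<rho>" "T \<rho> \<in> maximizers (takagi_fun c)" "\<rho> n * signed_sum c \<rho> n > 0"
  shows "sign_tail \<rho> n = 0"
proof -
  have "(\<rho> n * signed_sum c \<rho> n) * (\<rho> n * sign_tail \<rho> n) = signed_sum c \<rho> n * sign_tail \<rho> n"
    using sign_seqD[OF assms(1), of n] by auto
  then have "\<rho> n * sign_tail \<rho> n \<le> 0"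
    using maximizer_signed_sum_mult_tail[OF assms(1,2), of n] assms(3)
    by (metis mult_pos_pos not_le)
  then show ?thesis
    using sign_mult_tail_nonneg[OF assms(1), of n] sign_seqD[OF assms(1), of n] by auto
qed

text \<open>If an expansion violates the condition, the point has a second expansion, and that one
  satisfies it.\<close>

lemma maximizer_step_cond_expansion:
  assumes "t \<in> maximizers (takagi_fun c)" "t \<in> {0..1/2}"
  obtains \<rho> where "step_cond \<rho>" "T \<rho> = t"
proof -
  obtain \<rho> where \<rho>: "sign_seq \<rho>" "T \<rho> = t" "\<rho> 0 = 1"
    using sign_expansion_exists[of t] assms(2) by auto
  show thesis
  proof (cases "\<exists>n. \<rho> n * signed_sum c \<rho> n > 0")
    case False
    then show ?thesis
      using \<rho> that by (auto simp: step_cond_def not_less)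
  next
    case True
    then obtain n where n: "\<rho> n * signed_sum c \<rho> n > 0" by blast
    let ?\<sigma> = "flip_from n \<rho>"
    have "n > 0" using n by (cases n) auto
    have zero: "sign_tail \<rho> n = 0"
      using maximizer_sign_tail_eq_0[OF \<rho>(1) _ n] \<rho>(2) assms(1) by simp
    have sgn: "sign_seq ?\<sigma>" and T: "T ?\<sigma> = t"
      using sign_seq_flip_from T_flip_from[OF _ zero] \<rho> by auto
    \<comment> \<open>A new violation would force a second zero tail unless it occurs at
      \<open>n\<close>, where the flip has just reversed the sign of the product.\<close>
    have "?\<sigma> j * signed_sum c ?\<sigma> j \<le> 0" for j
    proof (rule ccontr)
      assume "\<not> ?thesis"
      then have j: "?\<sigma> j * signed_sum c ?\<sigma> j > 0" by simp
      then have "sign_tail ?\<sigma> j = 0"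
        using maximizer_sign_tail_eq_0[OF sgn] T assms(1) by simp
      moreover have "sign_tail ?\<sigma> n = 0"
        using zero by (simp add: sign_tail_flip_from_above[OF \<rho>(1)])
      ultimately have "j = n" by (rule sign_tail_zero_unique[OF sgn])
      moreover have "signed_sum c ?\<sigma> n = signed_sum c \<rho> n"
        by (intro signed_sum_cong) (simp add: flip_from_def)
      ultimately show False
        using n j by (simp add: flip_from_def)
    qed
    moreover have "?\<sigma> 0 = 1" using \<open>n > 0\<close> \<rho>(3) by (simp add: flip_from_def)
    ultimately show ?thesis
      using that T sgn by (auto simp: step_cond_def)
  qed
qed

text \<open>Compactness yields a maximizer in the unit interval. Flipping all signs reflects it at
  \<open>1 / 2\<close> and preserves the value, since the signed sum at 0 is zero.\<close>

lemma maximizer_exists: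
  obtains t where "t \<in> maximizers (takagi_fun c)" "t \<in> {0..1/2}"
proof -
  obtain s where s: "s \<in> maximizers (takagi_fun c)"
    using continuous_attains_sup[OF compact_Icc _ continuous_on_takagi_fun, of 0 1]
    by (auto simp: mem_maximizers_iff)
  then obtain \<rho> where \<rho>: "sign_seq \<rho>" "T \<rho> = s"
    using sign_expansion_exists[of s] by (auto simp: mem_maximizers_iff)
  consider "\<rho> 0 = 1" | "\<rho> 0 = - 1" using sign_seqD[OF \<rho>(1)] by blast
  then show thesis
  proof cases
    case 1
    then show ?thesis using that s \<rho> T_bounds_half by blast
  next
    case 2
    let ?\<sigma> = "flip_from 0 \<rho>"
    have sgn: "sign_seq ?\<sigma>" by (rule sign_seq_flip_from[OF \<rho>(1)])
    have "takagi_fun c (T ?\<sigma>) = takagi_fun c s"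
      using takagi_flip_from[OF \<rho>(1), of 0] \<rho>(2) by simp
    then have "T ?\<sigma> \<in> maximizers (takagi_fun c)"
      using s T_bounds[OF sgn] by (simp add: mem_maximizers_iff)
    moreover have "T ?\<sigma> \<in> {0..1/2}"
      using 2 by (intro T_bounds_half sgn) (simp add: flip_from_def)
    ultimately show ?thesis by (rule that)
  qed
qed

text \<open>Some maximizer has an expansion with the step condition, and all such expansions share
  one value.\<close>

lemma step_cond_maximizer:
  assumes "step_cond \<rho>"
  shows "T \<rho> \<in> maximizers (takagi_fun c) \<inter> {0..1/2}"
proof -
  obtain t where t: "t \<in> maximizers (takagi_fun c)" "t \<in> {0..1/2}" by (rule maximizer_exists)
  then obtain \<sigma> where "step_cond \<sigma>" "T \<sigma> = t" by (rule maximizer_step_cond_expansion)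
  then have "takagi_fun c (T \<rho>) = takagi_fun c t"
    using step_cond_takagi_eq assms by blast
  moreover have "T \<rho> \<in> {0..1/2}"
    using assms T_bounds_half by (auto simp: step_cond_def)
  ultimately show ?thesis
    using t by (auto simp: mem_maximizers_iff)
qed

section \<open>Extremality of the two recursive sequences\<close>

lemma rho_flat_Suc: "rho_flat c (Suc n) = (if signed_sum c (rho_flat c) (Suc n) < 0 then 1 else - 1)"
  by (simp add: signed_sum_def lessThan_Suc_atMost atLeast0AtMost del: signed_sum_Suc)

lemma rho_sharp_Suc: "rho_sharp c (Suc n) = (if signed_sum c (rho_sharp c) (Suc n) \<le> 0 then 1 else - 1)"
  by (simp add: signed_sum_def lessThan_Suc_atMost atLeast0AtMost del: signed_sum_Suc)

lemma step_cond_rho_flat: "step_cond (rho_flat c)"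
proof -
  have "(rho_flat c n = 1 \<or> rho_flat c n = - 1) \<and> rho_flat c n * signed_sum c (rho_flat c) n \<le> 0" for n
    by (cases n) (auto simp: rho_flat_Suc simp del: signed_sum_Suc rho_flat.simps(2))
  then show ?thesis by (simp add: step_cond_def sign_seq_def)
qed

lemma step_cond_rho_sharp: "step_cond (rho_sharp c)"
proof -
  have "(rho_sharp c n = 1 \<or> rho_sharp c n = - 1) \<and> rho_sharp c n * signed_sum c (rho_sharp c) n \<le> 0" for n
    by (cases n) (auto simp: rho_sharp_Suc simp del: signed_sum_Suc rho_sharp.simps(2))
  then show ?thesis by (simp add: step_cond_def sign_seq_def)
qed

text \<open>At the first place of disagreement both signed sums agree, and the step condition forces them
  to vanish.\<close>
lemma step_cond_first_difference:
  assumes "step_cond \<rho>" "step_cond \<sigma>" "\<rho> \<noteq> \<sigma>"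
  obtains n where "n > 0" "\<And>k. k < n \<Longrightarrow> \<rho> k = \<sigma> k" "\<rho> n = - \<sigma> n"
    "signed_sum c \<rho> n = 0" "signed_sum c \<sigma> n = 0"
proof -
  from assms(3) have "\<exists>n. \<rho> n \<noteq> \<sigma> n" by auto
  then obtain n where ne: "\<rho> n \<noteq> \<sigma> n" and below: "\<And>k. k < n \<Longrightarrow> \<rho> k = \<sigma> k"
    using exists_least_iff[of "\<lambda>n. \<rho> n \<noteq> \<sigma> n"] by auto
  have sgn: "sign_seq \<rho>" "sign_seq \<sigma>" using assms by (auto simp: step_cond_def)
  have opp: "\<rho> n = - \<sigma> n"
    using ne sign_seqD[OF sgn(1), of n] sign_seqD[OF sgn(2), of n] by auto
  have eq: "signed_sum c \<rho> n = signed_sum c \<sigma> n"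
    by (rule signed_sum_cong[OF below])
  have "signed_sum c \<sigma> n = 0"
    using step_cond_sign_mult[OF assms(1), of n] step_cond_sign_mult[OF assms(2), of n] opp eq
    by simp
  moreover have "n > 0"
    using ne assms(1,2) by (cases n) (auto simp: step_cond_def)
  ultimately show thesis
    using that below opp eq by simp
qed

lemma T_le_T_rho_flat:
  assumes "step_cond \<rho>"
  shows "T \<rho> \<le> T (rho_flat c)"
proof (cases "\<rho> = rho_flat c")
  case False
  then obtain n where n: "n > 0" "\<And>k. k < n \<Longrightarrow> \<rho> k = rho_flat c k" "\<rho> n = - rho_flat c n"
      "signed_sum c (rho_flat c) n = 0"
    using step_cond_first_difference[OF assms step_cond_rho_flat] by metis
  \<comment> \<open>The strict inequality in the recursion resolves a zero sum to
    \<open>- 1\<close>, the larger binary digit; \<open>n > 0\<close> makes the recursion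
    applicable.\<close>
  then have "rho_flat c n = - 1"
    using rho_flat_Suc[of "n - 1"] by (simp del: signed_sum_Suc rho_flat.simps(2))
  then show ?thesis
    using n assms step_cond_rho_flat by (intro T_mono_lex[of _ _ n]) (auto simp: step_cond_def)
qed simp

lemma T_rho_sharp_le_T:
  assumes "step_cond \<rho>"
  shows "T (rho_sharp c) \<le> T \<rho>"
proof (cases "rho_sharp c = \<rho>")
  case False
  then obtain n where n: "n > 0" "\<And>k. k < n \<Longrightarrow> rho_sharp c k = \<rho> k" "rho_sharp c n = - \<rho> n"
      "signed_sum c (rho_sharp c) n = 0"
    using step_cond_first_difference[OF step_cond_rho_sharp assms] by metis
  \<comment> \<open>Here the weak inequality resolves the tie to \<open>1\<close>, the smaller
    binary digit.\<close>
  then have "rho_sharp c n = 1"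
    using rho_sharp_Suc[of "n - 1"] by (simp del: signed_sum_Suc rho_sharp.simps(2))
  then show ?thesis
    using n assms step_cond_rho_sharp by (intro T_mono_lex[of _ _ n]) (auto simp: step_cond_def)
qed simp

end

theorem corollary2p4:
  fixes c :: "nat \<Rightarrow> real"
  assumes "summable (\<lambda>m. \<bar>c m\<bar>)"
  shows "is_largest (maximizers (takagi_fun c) \<inter> {0..1/2}) (T (rho_flat c))
    \<and> is_smallest (maximizers (takagi_fun c) \<inter> {0..1/2}) (T (rho_sharp c))"
proof -
  have "T (rho_sharp c) \<le> t \<and> t \<le> T (rho_flat c)"
    if "t \<in> maximizers (takagi_fun c) \<inter> {0..1/2}" for t
    using that maximizer_step_cond_expansion[OF assms, of t]
      T_rho_sharp_le_T[OF assms] T_le_T_rho_flat[OF assms] by (metis IntD1 IntD2)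
  then show ?thesis
    using step_cond_maximizer[OF assms step_cond_rho_flat[OF assms]]
      step_cond_maximizer[OF assms step_cond_rho_sharp[OF assms]]
    by (auto simp: is_largest_def is_smallest_def)
qed

end
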